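(* For every positive integer $n$, $\widehat{p}(K_n)\ge \widehat{p}(K_{n,n})-1$.
   Context: $K_n$ is the complete graph on $n$ vertices and $K_{n,n}$ is the complete bipartite graph with both partite sets of size $n$. An edge-coloring of a graph $G$ is any assignment of colors to its edges. A walk is closed if its two endpoints coincide, and open otherwise. A parity walk (in an edge-coloring) is a walk along which every color is used an even number of times (counting repeated traversals). A strong parity edge-coloring (spec) is an edge-coloring in which every parity walk is closed, and $\widehat{p}(G)$ is the minimum number of colors in a spec of $G$. *)

theory Defs
  imports "Graph_Theory.Graph_Theory"
begin

text \<open>
  As in \<^theory>\<open>Graph_Theory.Kuratowski\<close>, a finite simple graph is a symmetric loop-free
  digraph without parallel arcs (locale \<^locale>\<open>graph\<close>). Both orientations of an undirected
  edge are arcs; the edge itself is the set of its two ends. Colors are attached to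
  edges in this sense, so the two orientations always share their color.
\<close>

definition uedge :: "('a, 'b) pre_digraph \<Rightarrow> 'b \<Rightarrow> 'a set" where
  "uedge G a = {tail G a, head G a}"

definition uedges :: "('a, 'b) pre_digraph \<Rightarrow> 'a set set" where
  "uedges G = uedge G ` arcs G"

definition parity_walk ::
  "('a, 'b) pre_digraph \<Rightarrow> ('a set \<Rightarrow> nat) \<Rightarrow> 'a \<Rightarrow> 'b awalk \<Rightarrow> 'a \<Rightarrow> bool" where
  "parity_walk G c u p v \<longleftrightarrow>
     pre_digraph.awalk G u p v \<and>
     (\<forall>k. even (count_list (map (\<lambda>a. c (uedge G a)) p) k))"

definition strong_parity_edge_coloring ::
  "('a, 'b) pre_digraph \<Rightarrow> ('a set \<Rightarrow> nat) \<Rightarrow> bool" where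
  "strong_parity_edge_coloring G c \<longleftrightarrow> (\<forall>u p v. parity_walk G c u p v \<longrightarrow> u = v)"

text \<open>
  Only colors occurring on edges of the graph are counted. Natural numbers are a
  sufficient supply of colors, since the graphs are finite; the lemmas below show that
  the minimum is attained.
\<close>

definition p_hat :: "('a, 'b) pre_digraph \<Rightarrow> nat" where
  "p_hat G = (LEAST k. \<exists>c. strong_parity_edge_coloring G c \<and> card (c ` uedges G) = k)"

lemma length_filter_eq_sum_count_list:
  assumes "finite S"
  shows "length (filter (\<lambda>a. f a \<in> S) p) = (\<Sum>k\<in>S. count_list (map f p) k)"
proof (induction p)
  case (Cons a p)
  have "(\<Sum>k\<in>S. count_list (map f (a # p)) k)
      = (\<Sum>k\<in>S. count_list (map f p) k + (if f a = k then 1 else 0))"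
    by (intro sum.cong) auto
  then show ?case using Cons assms by (simp add: sum.distrib)
qed simp

lemma (in graph) even_incidences:
  assumes "awalk u p v"
  shows "even (length (filter (\<lambda>a. x \<in> uedge G a) p)) \<longleftrightarrow> (u = x \<longleftrightarrow> v = x)"
  using assms
proof (induction p arbitrary: u)
  case Nil
  then show ?case by (simp add: awalk_Nil_iff)
next
  case (Cons a p)
  then have a: "a \<in> arcs G" "tail G a = u" and p: "awalk (head G a) p v"
    by (simp_all add: awalk_Cons_iff)
  have "tail G a \<noteq> head G a" using a no_loops by blast
  then show ?case using Cons.IH[OF p] a by (auto simp: uedge_def)
qed

lemma (in graph) strong_parity_edge_coloring_exists:
  "\<exists>c. strong_parity_edge_coloring G c"
proof -
  have "finite (uedges G)" by (simp add: uedges_def)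
  then obtain c :: "'a set \<Rightarrow> nat" where c: "inj_on c (uedges G)"
    using finite_imp_inj_to_nat_seg by blast
  have "u = v" if "parity_walk G c u p v" for u p v
  proof -
    define S where "S = c ` {e \<in> uedges G. u \<in> e}"
    have w: "awalk u p v" using that by (simp add: parity_walk_def)
    then have arcs: "set p \<subseteq> arcs G" by (simp add: awalk_def)
    have "c (uedge G a) \<in> S \<longleftrightarrow> u \<in> uedge G a" if "a \<in> set p" for a
    proof -
      have "uedge G a \<in> uedges G" using arcs that by (auto simp: uedges_def)
      then show ?thesis using inj_onD[OF c] by (auto simp: S_def)
    qed
    then have "filter (\<lambda>a. u \<in> uedge G a) p = filter (\<lambda>a. c (uedge G a) \<in> S) p"
      by (intro filter_cong) auto
    moreover have "finite S" using \<open>finite (uedges G)\<close> by (simp add: S_def)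
    ultimately have "even (length (filter (\<lambda>a. u \<in> uedge G a) p))"
      using that by (auto simp: length_filter_eq_sum_count_list parity_walk_def intro!: dvd_sum)
    then show "u = v" using even_incidences[OF w, of u] by simp
  qed
  then show ?thesis unfolding strong_parity_edge_coloring_def by blast
qed

lemma (in graph) p_hat_attained:
  "\<exists>c. strong_parity_edge_coloring G c \<and> card (c ` uedges G) = p_hat G"
  unfolding p_hat_def by (rule LeastI_ex) (use strong_parity_edge_coloring_exists in blast)

lemma p_hat_le:
  "strong_parity_edge_coloring G c \<Longrightarrow> p_hat G \<le> card (c ` uedges G)"
  unfolding p_hat_def by (rule Least_le) blast

end

theory Submission
  imports Defs
begin

text \<open>
  Identify each partite set of \<open>K\<^bsub>n,n\<^esub>\<close> with the vertex set of \<open>K\<^bsub>n\<^esub>\<close>. Given an optimal spec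
  of \<open>K\<^bsub>n\<^esub>\<close>, color an edge of \<open>K\<^bsub>n,n\<^esub>\<close> like its projection to \<open>K\<^bsub>n\<^esub>\<close>, and give one new color to the
  perfect matching of edges that collapse to a vertex. A parity walk projects to a parity
  walk of \<open>K\<^bsub>n\<^esub>\<close> once the collapsed steps are dropped, so its ends have the same projection;
  since its length is even, they also lie in the same partite set, and hence coincide.
\<close>

text \<open>Here \<open>h\<close> projects onto the smaller graph. An edge collapses exactly when
  its image is a singleton; \<open>m\<close> is the color of all collapsed edges.\<close>

definition pullback_coloring :: "('c \<Rightarrow> 'a) \<Rightarrow> ('a set \<Rightarrow> nat) \<Rightarrow> nat \<Rightarrow> 'c set \<Rightarrow> nat" where
  "pullback_coloring h c m e = (if is_singleton (h ` e) then m else c (h ` e))"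

lemma is_singleton_pair [simp]: "is_singleton {x, y} \<longleftrightarrow> x = y"
  by (auto simp: is_singleton_def)

text \<open>Dropping the collapsed steps deletes exactly the occurrences of \<open>m\<close>: other
  steps take a color used on \<open>G\<close>, which \<open>m\<close> is not. Since 0 is even, even
  color counts stay even.\<close>

lemma awalk_pullback:
  assumes "wf_digraph G" and "wf_digraph H"
    and verts: "h ` verts H \<subseteq> verts G"
    and adj: "\<And>a. a \<in> arcs H \<Longrightarrow> h (tail H a) \<noteq> h (head H a) \<Longrightarrow>
      (h (tail H a), h (head H a)) \<in> arcs_ends G"
    and fresh: "m \<notin> c ` uedges G"
    and walk: "pre_digraph.awalk H u p v"
  shows "\<exists>q. pre_digraph.awalk G (h u) q (h v) \<and>
    (\<forall>k. count_list (map (\<lambda>a. c (uedge G a)) q) k =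
      (if k = m then 0
       else count_list (map (\<lambda>a. pullback_coloring h c m (uedge H a)) p) k))"
proof -
  interpret G: wf_digraph G by fact
  interpret H: wf_digraph H by fact
  show ?thesis
    using walk
  proof (induction p arbitrary: u)
    case Nil
    then show ?case using verts
      by (intro exI[of _ "[]"]) (auto simp: H.awalk_Nil_iff G.awalk_Nil_iff)
  next
    case (Cons a p)
    then have a: "a \<in> arcs H" "tail H a = u" and p: "H.awalk (head H a) p v"
      by (simp_all add: H.awalk_Cons_iff)
    obtain q where q: "G.awalk (h (head H a)) q (h v)"
      and count: "\<And>k. count_list (map (\<lambda>a. c (uedge G a)) q) k =
        (if k = m then 0
         else count_list (map (\<lambda>a. pullback_coloring h c m (uedge H a)) p) k)"
      using Cons.IH[OF p] by blast
    show ?case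
    proof (cases "h u = h (head H a)")
      case True
      \<comment> \<open>A collapsed step has color \<open>m\<close>, which the count on the right
        ignores, so \<open>q\<close> still serves.\<close>
      then show ?thesis using q count a
        by (intro exI[of _ q]) (auto simp: pullback_coloring_def uedge_def)
    next
      case False
      then obtain b where b: "b \<in> arcs G" "tail G b = h u" "head G b = h (head H a)"
        using adj[OF a(1)] a(2) by (auto simp: arcs_ends_conv)
      have "c (uedge G b) \<noteq> m" using fresh b(1) by (auto simp: uedges_def)
      moreover have "pullback_coloring h c m (uedge H a) = c (uedge G b)"
        using False a b by (simp add: pullback_coloring_def uedge_def)
      ultimately show ?thesis using q count b
        by (intro exI[of _ "b # q"]) (auto simp: G.awalk_Cons_iff)
    qed
  qed
qed

text \<open>The length is the sum of the counts of the colors that occur, all of them even.\<close>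

lemma parity_walk_even_length:
  assumes "parity_walk G c u p v"
  shows "even (length p)"
proof -
  let ?xs = "map (\<lambda>a. c (uedge G a)) p"
  have "even (\<Sum>k\<in>set ?xs. count_list ?xs k)"
    using assms by (intro dvd_sum) (simp add: parity_walk_def)
  then show ?thesis using sum_count_set[of ?xs "set ?xs"] by simp
qed

text \<open>Each step switches sides.\<close>

lemma (in wf_digraph) bipartite_walk_even_iff:
  assumes "\<And>a. a \<in> arcs G \<Longrightarrow> tail G a \<in> U \<longleftrightarrow> head G a \<notin> U"
    and "awalk u p v"
  shows "even (length p) \<longleftrightarrow> (u \<in> U \<longleftrightarrow> v \<in> U)"
  using assms(2)
proof (induction p arbitrary: u)
  case (Cons a p)
  then show ?case using assms(1)[of a] by (auto simp: awalk_Cons_iff)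
qed (simp add: awalk_Nil_iff)

text \<open>The map \<open>h\<close> is injective only on each side, so equal projections leave open
  that \<open>u\<close> and \<open>v\<close> are opposite vertices; even length rules this
  out.\<close>

lemma strong_parity_pullback_coloring:
  assumes "wf_digraph G" and "wf_digraph H"
    and verts: "verts H = U \<union> V" "h ` U \<subseteq> verts G" "h ` V \<subseteq> verts G"
    and inj: "inj_on h U" "inj_on h V"
    and bip: "\<And>a. a \<in> arcs H \<Longrightarrow> tail H a \<in> U \<longleftrightarrow> head H a \<notin> U"
    and adj: "\<And>a. a \<in> arcs H \<Longrightarrow> h (tail H a) \<noteq> h (head H a) \<Longrightarrow>
      (h (tail H a), h (head H a)) \<in> arcs_ends G"
    and fresh: "m \<notin> c ` uedges G"
    and spec: "strong_parity_edge_coloring G c"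
  shows "strong_parity_edge_coloring H (pullback_coloring h c m)"
  unfolding strong_parity_edge_coloring_def
proof (intro allI impI)
  interpret H: wf_digraph H by fact
  fix u p v assume parity: "parity_walk H (pullback_coloring h c m) u p v"
  then have walk: "H.awalk u p v" by (simp add: parity_walk_def)
  have "h ` verts H \<subseteq> verts G" using verts by auto
  then obtain q where "parity_walk G c (h u) q (h v)"
    using awalk_pullback[OF assms(1,2) _ adj fresh walk] parity
    unfolding parity_walk_def by (metis even_zero)
  then have "h u = h v" using spec by (simp add: strong_parity_edge_coloring_def)
  moreover have "u \<in> U \<longleftrightarrow> v \<in> U"
    using H.bipartite_walk_even_iff[OF bip walk] parity_walk_even_length[OF parity] by simp
  moreover have "u \<in> U \<union> V" "v \<in> U \<union> V"
    using walk verts(1) by (auto dest: H.awalk_hd_in_verts H.awalk_last_in_verts)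
  ultimately show "u = v" using inj by (auto dest: inj_onD)
qed

theorem proposition4p4:
  fixes n :: nat
    and G :: "('a, 'b) pre_digraph"
    and H :: "('c, 'd) pre_digraph"
  assumes "n > 0"
    and "K\<^bsub>n\<^esub> G"
    and "K\<^bsub>n,n\<^esub> H"
  shows "int (p_hat G) \<ge> int (p_hat H) - 1"
proof -
  interpret G: graph G using assms(2) by (simp add: complete_digraph_def)
  interpret H: graph H using assms(3) by (simp add: complete_bipartite_digraph_def)
  have G: "card (verts G) = n" "arcs_ends G = {(u, v). (u, v) \<in> verts G \<times> verts G \<and> u \<noteq> v}"
    using assms(2) by (auto simp: complete_digraph_def)
  obtain U V where UV: "verts H = U \<union> V" "U \<inter> V = {}" "card U = n" "card V = n"
    and ends: "arcs_ends H = U \<times> V \<union> V \<times> U"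
    using assms(3) unfolding complete_bipartite_digraph_def by blast
  have "finite U" "finite V" using H.finite_verts UV(1) by auto
  then obtain f g where f: "bij_betw f U (verts G)" and g: "bij_betw g V (verts G)"
    using finite_same_card_bij[OF _ G.finite_verts] UV G by metis
  \<comment> \<open>The two identifications are glued into one map; on \<open>V\<close> it agrees
    with \<open>g\<close> because the sides are disjoint.\<close>
  define h where "h x = (if x \<in> U then f x else g x)" for x
  have hU: "bij_betw h U (verts G)"
    using f by (rule bij_betw_cong[THEN iffD1, rotated]) (simp add: h_def)
  have hV: "bij_betw h V (verts G)"
    using g by (rule bij_betw_cong[THEN iffD1, rotated]) (use UV(2) in \<open>auto simp: h_def\<close>)
  obtain c where c: "strong_parity_edge_coloring G c" "card (c ` uedges G) = p_hat G"
    using G.p_hat_attained by blast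
  have fin: "finite (c ` uedges G)" by (simp add: uedges_def)
  then obtain m where m: "m \<notin> c ` uedges G"
    using ex_new_if_finite infinite_UNIV_nat by blast
  have arc_ends: "(tail H a, head H a) \<in> U \<times> V \<union> V \<times> U" if "a \<in> arcs H" for a
    using that ends by (metis H.in_arcs_imp_in_arcs_ends)
  \<comment> \<open>Completeness of \<open>G\<close> enters here: any two distinct vertices are
    joined by an arc.\<close>
  have adj: "(h (tail H a), h (head H a)) \<in> arcs_ends G"
    if "a \<in> arcs H" "h (tail H a) \<noteq> h (head H a)" for a
    using arc_ends[OF that(1)] that(2) bij_betwE[OF hU] bij_betwE[OF hV] by (auto simp: G)
  have bip: "tail H a \<in> U \<longleftrightarrow> head H a \<notin> U" if "a \<in> arcs H" for a
    using arc_ends[OF that] UV(2) by auto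
  have "strong_parity_edge_coloring H (pullback_coloring h c m)"
    by (rule strong_parity_pullback_coloring[of G H U V])
      (use hU hV UV(1) adj bip m c(1) G.wf_digraph H.wf_digraph
        in \<open>auto simp: bij_betw_def\<close>)
  then have "p_hat H \<le> card (pullback_coloring h c m ` uedges H)" by (rule p_hat_le)
  \<comment> \<open>An edge that does not collapse takes the color of its image edge in
    \<open>G\<close>, so \<open>m\<close> is the only additional color; it accounts for the 1 in the
    bound.\<close>
  also have "\<dots> \<le> card (insert m (c ` uedges G))"
  proof (rule card_mono)
    have "pullback_coloring h c m (uedge H a) \<in> insert m (c ` uedges G)"
      if arc: "a \<in> arcs H" for a
    proof (cases "h (tail H a) = h (head H a)")
      case False
      then obtain b where "b \<in> arcs G" "tail G b = h (tail H a)" "head G b = h (head H a)"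
        using adj[OF arc False] by (auto simp: arcs_ends_conv)
      then show ?thesis using False
        by (auto simp: pullback_coloring_def uedges_def uedge_def intro!: image_eqI[of _ _ b])
    qed (simp add: pullback_coloring_def uedge_def)
    then show "pullback_coloring h c m ` uedges H \<subseteq> insert m (c ` uedges G)"
      by (auto simp: uedges_def)
  qed (use fin in simp)
  also have "\<dots> = Suc (p_hat G)" using fin m c(2) by simp
  finally show ?thesis by simp
qed

end
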